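(* Let $\dot{\mathbf{A}}\in\mathbb{H}^{M\times N}$, let $K\le l\le\min(M,N)$ and $p\ge 1$ be positive integers, and let $\dot{\mathbf{Q}}_1\in\mathbb{H}^{M\times l}$ and $\dot{\mathbf{Q}}_2\in\mathbb{H}^{N\times l}$ be the quaternion matrices with orthonormal columns constructed from $\dot{\mathbf{A}}$ by the CoR-QURV algorithm with parameters $l,p$. Let $\dot{\mathbf{M}}_K$ be the best rank-$K$ approximation (in Frobenius norm) of $\dot{\mathbf{Q}}_1^H\dot{\mathbf{A}}\dot{\mathbf{Q}}_2\in\mathbb{H}^{l\times l}$, and let $\dot{\mathbf{A}}_K$ be the best rank-$K$ approximation of $\dot{\mathbf{A}}$. Then $\dot{\mathbf{M}}_K$ is an optimal solution of the following optimization problem over $\dot{\mathbf{M}}\in\mathbb{H}^{l\times l}$: $$\min_{\dot{\mathbf{M}},\ \operatorname{rank}(\dot{\mathbf{M}})\le K}\|\dot{\mathbf{A}}-\dot{\mathbf{Q}}_1\dot{\mathbf{M}}\dot{\mathbf{Q}}_2^H\|_F=\|\dot{\mathbf{A}}-\dot{\mathbf{Q}}_1\dot{\mathbf{M}}_K\dot{\mathbf{Q}}_2^H\|_F .$$ Moreover, $$\|\dot{\mathbf{A}}-\dot{\mathbf{Q}}_1\dot{\mathbf{M}}_K\dot{\mathbf{Q}}_2^H\|_F\le\|\dot{\mathbf{A}}-\dot{\mathbf{A}}_K\|_F+\|\dot{\mathbf{A}}_K-\dot{\mathbf{Q}}_1\dot{\mathbf{Q}}_1^H\dot{\mathbf{A}}_K\|_F+\|\dot{\mathbf{A}}_K-\dot{\mathbf{A}}_K\dot{\mathbf{Q}}_2\dot{\mathbf{Q}}_2^H\|_F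 .$$
   Context: $\mathbb{H}$ denotes the real quaternions. The rank of a quaternion matrix is the maximum number of right linearly independent columns. The Frobenius norm is $\|\dot{\mathbf{A}}\|_F=(\sum_{i,j}|\dot a_{ij}|^2)^{1/2}$, and $^H$ is conjugate transpose. A best rank-$K$ approximation of a quaternion matrix is a minimizer of the Frobenius distance among matrices of rank at most $K$, obtained by truncating its quaternion singular value decomposition to the $K$ largest singular values. CoR-QURV algorithm (construction of $\dot{\mathbf{Q}}_1,\dot{\mathbf{Q}}_2$): draw a random test matrix $\dot{\mathbf{\Omega}}=\mathbf{\Omega}_0+\mathbf{\Omega}_1 i+\mathbf{\Omega}_2 j+\mathbf{\Omega}_3 k\in\mathbb{H}^{N\times l}$, where the real matrices $\mathbf{\Omega}_0,\dots,\mathbf{\Omega}_3$ have independent $N(0,1)$ entries and are independent of each other. Set $\dot{\mathbf{Y}}_0=\dot{\mathbf{A}}\dot{\mathbf{\Omega}}$ and, for $i=1,\dots,p$, $\hat{\dot{\mathbf{Y}}}_i=\dot{\mathbf{A}}^H\dot{\mathbf{Y}}_{i-1}$ and $\dot{\mathbf{Y}}_i=\dot{\mathbf{A}}\hat{\dot{\mathbf{Y}}}_i$. Compute thin quaternion QR factorizations $\dot{\mathbf{Y}}_p=\dot{\mathbf{Q}}_1\dot{\mathbf{R}}_1$ and $\hat{\dot{\mathbf{Y}}}_p=\dot{\mathbf{Q}}_2\dot{\mathbf{R}}_2$, with $\dot{\mathbf{Q}}_1\in\mathbb{H}^{M\times l}$, $\dot{\mathbf{Q}}_2\in\mathbb{H}^{N\times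 l}$, $\dot{\mathbf{Q}}_1^H\dot{\mathbf{Q}}_1=\dot{\mathbf{Q}}_2^H\dot{\mathbf{Q}}_2=\mathbf{I}_l$. The theorem holds for every realization of $\dot{\mathbf{\Omega}}$. *)

theory Defs
  imports "HOL-Analysis.Inner_Product" "Jordan_Normal_Form.Matrix"
begin

codatatype quat = Quat (Re0: real) (Im1: real) (Im2: real) (Im3: real)

lemma quat_eq_iff:
  "x = y \<longleftrightarrow> Re0 x = Re0 y \<and> Im1 x = Im1 y \<and> Im2 x = Im2 y \<and> Im3 x = Im3 y"
  by (auto intro: quat.expand)

instantiation quat :: ab_group_add
begin

primcorec zero_quat where
  "Re0 0 = 0" | "Im1 0 = 0" | "Im2 0 = 0" | "Im3 0 = 0"

primcorec plus_quat where
  "Re0 (x + y) = Re0 x + Re0 y"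
| "Im1 (x + y) = Im1 x + Im1 y"
| "Im2 (x + y) = Im2 x + Im2 y"
| "Im3 (x + y) = Im3 x + Im3 y"

primcorec uminus_quat where
  "Re0 (- x) = - Re0 x"
| "Im1 (- x) = - Im1 x"
| "Im2 (- x) = - Im2 x"
| "Im3 (- x) = - Im3 x"

primcorec minus_quat where
  "Re0 (x - y) = Re0 x - Re0 y"
| "Im1 (x - y) = Im1 x - Im1 y"
| "Im2 (x - y) = Im2 x - Im2 y"
| "Im3 (x - y) = Im3 x - Im3 y"

instance
  by standard (simp_all add: quat_eq_iff)

end

text \<open>Hamilton's product, with \<open>ij = k\<close>, \<open>jk = i\<close>, \<open>ki = j\<close>.\<close>

instantiation quat :: ring_1
begin

primcorec one_quat where
  "Re0 1 = 1" | "Im1 1 = 0" | "Im2 1 = 0" | "Im3 1 = 0"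

primcorec times_quat where
  "Re0 (x * y) = Re0 x * Re0 y - Im1 x * Im1 y - Im2 x * Im2 y - Im3 x * Im3 y"
| "Im1 (x * y) = Re0 x * Im1 y + Im1 x * Re0 y + Im2 x * Im3 y - Im3 x * Im2 y"
| "Im2 (x * y) = Re0 x * Im2 y - Im1 x * Im3 y + Im2 x * Re0 y + Im3 x * Im1 y"
| "Im3 (x * y) = Re0 x * Im3 y + Im1 x * Im2 y - Im2 x * Im1 y + Im3 x * Re0 y"

instance
  by standard (simp_all add: quat_eq_iff algebra_simps)

end

primcorec qcnj :: "quat \<Rightarrow> quat" where
  "Re0 (qcnj x) = Re0 x"
| "Im1 (qcnj x) = - Im1 x"
| "Im2 (qcnj x) = - Im2 x"
| "Im3 (qcnj x) = - Im3 x"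

instantiation quat :: real_algebra_1
begin

primcorec scaleR_quat where
  "Re0 (scaleR r x) = r * Re0 x"
| "Im1 (scaleR r x) = r * Im1 x"
| "Im2 (scaleR r x) = r * Im2 x"
| "Im3 (scaleR r x) = r * Im3 x"

instance
  by standard (simp_all add: quat_eq_iff algebra_simps)

end

instantiation quat :: real_inner
begin

definition inner_quat :: "quat \<Rightarrow> quat \<Rightarrow> real" where
  "inner_quat x y = Re0 x * Re0 y + Im1 x * Im1 y + Im2 x * Im2 y + Im3 x * Im3 y"

definition norm_quat :: "quat \<Rightarrow> real" where
  "norm_quat x = sqrt ((Re0 x)\<^sup>2 + (Im1 x)\<^sup>2 + (Im2 x)\<^sup>2 + (Im3 x)\<^sup>2)"

definition sgn_quat :: "quat \<Rightarrow> quat" where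
  "sgn_quat x = x /\<^sub>R norm x"

definition dist_quat :: "quat \<Rightarrow> quat \<Rightarrow> real" where
  "dist_quat x y = norm (x - y)"

definition uniformity_quat :: "(quat \<times> quat) filter" where
  "uniformity_quat = (INF e\<in>{0 <..}. principal {(x, y). dist x y < e})"

definition open_quat :: "quat set \<Rightarrow> bool" where
  "open_quat U \<longleftrightarrow> (\<forall>x\<in>U. eventually (\<lambda>(x', y). x' = x \<longrightarrow> y \<in> U) uniformity)"

instance
proof
  fix x y z :: quat and r :: real
  show "inner x x = 0 \<longleftrightarrow> x = 0"
    by (simp add: inner_quat_def quat_eq_iff add_nonneg_eq_0_iff)
  show "norm x = sqrt (inner x x)"
    by (simp add: inner_quat_def norm_quat_def power2_eq_square)
qed (simp_all add: inner_quat_def algebra_simps sgn_quat_def dist_quat_def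
      uniformity_quat_def open_quat_def)

end

instantiation quat :: real_normed_div_algebra
begin

definition inverse_quat :: "quat \<Rightarrow> quat" where
  "inverse_quat x = qcnj x /\<^sub>R (norm x)\<^sup>2"

definition divide_quat :: "quat \<Rightarrow> quat \<Rightarrow> quat" where
  "divide_quat x y = x * inverse y"

instance
proof
  fix x y :: quat
  have n2: "(norm x)\<^sup>2 = (Re0 x)\<^sup>2 + (Im1 x)\<^sup>2 + (Im2 x)\<^sup>2 + (Im3 x)\<^sup>2" for x :: quat
    by (simp add: norm_quat_def)
  have cx: "qcnj x * x = (norm x)\<^sup>2 *\<^sub>R 1" and xc: "x * qcnj x = (norm x)\<^sup>2 *\<^sub>R 1"
    unfolding n2 by (simp_all add: quat_eq_iff power2_eq_square)
  show "inverse x * x = 1" if "x \<noteq> 0"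
    using that cx by (simp add: inverse_quat_def)
  show "x * inverse x = 1" if "x \<noteq> 0"
    using that xc by (simp add: inverse_quat_def)
  show "x div y = x * inverse y"
    by (simp add: divide_quat_def)
  show "inverse (0 :: quat) = 0"
    by (simp add: inverse_quat_def)
  have "(norm (x * y))\<^sup>2 = (norm x * norm y)\<^sup>2"
    unfolding power_mult_distrib n2 by (simp add: power2_eq_square algebra_simps)
  then show "norm (x * y) = norm x * norm y"
    by (simp add: power2_eq_iff_nonneg)
qed

end

text \<open>The matrix type of the library allows noncommutative entries: an entry of \<open>A * B\<close> is a sum of
  products with the factor from \<open>A\<close> on the left. Its conjugation classes do not cover quaternions,
  because quaternion conjugation reverses products.\<close>

definition herm :: "quat mat \<Rightarrow> quat mat" ("(_\<^sup>H)" [1000] 999) where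
  "A\<^sup>H = mat (dim_col A) (dim_row A) (\<lambda>(i, j). qcnj (A $$ (j, i)))"

definition frob_norm :: "quat mat \<Rightarrow> real" where
  "frob_norm A = sqrt (\<Sum>i<dim_row A. \<Sum>j<dim_col A. (norm (A $$ (i, j)))\<^sup>2)"

text \<open>Independence is stated for families of column indices, so that repeated columns are
  dependent; scalars act from the right.\<close>

definition right_indep_cols :: "quat mat \<Rightarrow> nat set \<Rightarrow> bool" where
  "right_indep_cols A S \<longleftrightarrow> S \<subseteq> {..<dim_col A} \<and>
     (\<forall>c :: nat \<Rightarrow> quat.
        (\<forall>i<dim_row A. (\<Sum>j\<in>S. A $$ (i, j) * c j) = 0) \<longrightarrow> (\<forall>j\<in>S. c j = 0))"

definition qrank :: "quat mat \<Rightarrow> nat" where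
  "qrank A = Max (card ` {S. right_indep_cols A S})"

text \<open>Minimizers need not be unique; each of them counts as a best approximation, in particular
  every truncation of a quaternion singular value decomposition to the \<open>K\<close> largest singular values.\<close>

definition is_best_rank_approx :: "nat \<Rightarrow> quat mat \<Rightarrow> quat mat \<Rightarrow> bool" where
  "is_best_rank_approx K A B \<longleftrightarrow>
     is_arg_min (\<lambda>C. frob_norm (A - C))
       (\<lambda>C. C \<in> carrier_mat (dim_row A) (dim_col A) \<and> qrank C \<le> K) B"

definition thin_qr :: "quat mat \<Rightarrow> quat mat \<Rightarrow> quat mat \<Rightarrow> bool" where
  "thin_qr Y Q R \<longleftrightarrow>
     Q \<in> carrier_mat (dim_row Y) (dim_col Y) \<and> R \<in> carrier_mat (dim_col Y) (dim_col Y) \<and>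
     Q\<^sup>H * Q = 1\<^sub>m (dim_col Y) \<and> upper_triangular R \<and> Y = Q * R"

fun power_Y :: "quat mat \<Rightarrow> quat mat \<Rightarrow> nat \<Rightarrow> quat mat" where
  "power_Y A \<Omega> 0 = A * \<Omega>"
| "power_Y A \<Omega> (Suc i) = A * (A\<^sup>H * power_Y A \<Omega> i)"

text \<open>Meaningful only for \<open>i \<ge> 1\<close>; then \<open>power_Y A \<Omega> i = A * power_Yhat A \<Omega> i\<close>.\<close>

definition power_Yhat :: "quat mat \<Rightarrow> quat mat \<Rightarrow> nat \<Rightarrow> quat mat" where
  "power_Yhat A \<Omega> i = A\<^sup>H * power_Y A \<Omega> (i - 1)"

text \<open>\<open>Q1\<close> and \<open>Q2\<close> are an output of the algorithm for the realization \<open>\<Omega>\<close> of the random test matrix.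
  QR factors need not be unique; every choice is allowed.\<close>

definition cor_qurv :: "quat mat \<Rightarrow> quat mat \<Rightarrow> nat \<Rightarrow> nat \<Rightarrow> quat mat \<Rightarrow> quat mat \<Rightarrow> bool" where
  "cor_qurv A \<Omega> l p Q1 Q2 \<longleftrightarrow>
     \<Omega> \<in> carrier_mat (dim_col A) l \<and>
     (\<exists>R1. thin_qr (power_Y A \<Omega> p) Q1 R1) \<and> (\<exists>R2. thin_qr (power_Yhat A \<Omega> p) Q2 R2)"

end

theory Submission
  imports Defs "HOL-Analysis.L2_Norm"
begin

text \<open>Put \<open>B = Q\<^sub>1\<^sup>H A Q\<^sub>2\<close>. The residual \<open>A - Q\<^sub>1 B Q\<^sub>2\<^sup>H\<close> is orthogonal to every \<open>Q\<^sub>1 D Q\<^sub>2\<^sup>H\<close> in the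
  real inner product \<open>Re tr(X\<^sup>H Y)\<close>, and \<open>D \<mapsto> Q\<^sub>1 D Q\<^sub>2\<^sup>H\<close> is an isometry, so Pythagoras gives
  \<open>\<parallel>A - Q\<^sub>1 X Q\<^sub>2\<^sup>H\<parallel>\<^sup>2 = \<parallel>A - Q\<^sub>1 B Q\<^sub>2\<^sup>H\<parallel>\<^sup>2 + \<parallel>B - X\<parallel>\<^sup>2\<close>, and minimizing over \<open>X\<close> means approximating \<open>B\<close>.
  For the bound, \<open>X = Q\<^sub>1\<^sup>H A\<^sub>K Q\<^sub>2\<close> is a competitor, as multiplication does not increase the rank.
  Its residual is \<open>(A - A\<^sub>K) + (A\<^sub>K - P\<^sub>1 A\<^sub>K) + P\<^sub>1 (A\<^sub>K - A\<^sub>K P\<^sub>2)\<close> with the orthogonal projections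
  \<open>P\<^sub>i = Q\<^sub>i Q\<^sub>i\<^sup>H\<close>, and projections do not increase the norm.\<close>

section \<open>Rank over a division ring\<close>

text \<open>Gaussian elimination, one equation per induction step. Coefficients stand on the left
  and unknowns on the right, so equations may be multiplied from the left, which is all that
  elimination requires over a division ring.\<close>

lemma homogeneous_system_nontrivial_solution:
  fixes a :: "'i \<Rightarrow> 'j \<Rightarrow> 'r::division_ring"
  assumes "finite I" "finite T" "card I < card T"
  shows "\<exists>c. (\<exists>j\<in>T. c j \<noteq> 0) \<and> (\<forall>i\<in>I. (\<Sum>j\<in>T. a i j * c j) = 0)"
  using assms
proof (induction I arbitrary: T a rule: finite_induct)
  case empty
  then obtain j where "j \<in> T"
    by (metis card.empty card_gt_0_iff ex_in_conv)
  then show ?case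
    by (intro exI[of _ "\<lambda>_. 1"]) auto
next
  case (insert i I)
  show ?case
  proof (cases "\<forall>j\<in>T. a i j = 0")
    case True
    obtain c where "\<exists>j\<in>T. c j \<noteq> 0" "\<forall>k\<in>I. (\<Sum>j\<in>T. a k j * c j) = 0"
      using insert.IH[of T a] insert.prems insert.hyps by auto
    with True show ?thesis
      by (intro exI[of _ c]) auto
  next
    case False
    then obtain t where t: "t \<in> T" "a i t \<noteq> 0" by blast
    define T' where "T' = T - {t}"
    \<comment> \<open>The pivot equation divided from the left by its coefficient at
      \<open>t\<close>; it then reads \<open>c t = - (\<Sum>j\<in>T'. u j * c j)\<close>.
      Substituting this for the unknown at \<open>t\<close> gives the reduced system below.\<close>
    define u where "u j = inverse (a i t) * a i j" for j
    have fin: "finite T'" "t \<notin> T'" and T: "T = insert t T'"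
      using insert.prems t by (auto simp: T'_def)
    have "card I < card T'"
      using insert.prems insert.hyps T fin by simp
    then obtain c where c: "\<exists>j\<in>T'. c j \<noteq> 0" 
      and sol: "\<And>k. k \<in> I \<Longrightarrow> (\<Sum>j\<in>T'. (a k j - a k t * u j) * c j) = 0"
      using insert.IH[OF fin(1), of "\<lambda>k j. a k j - a k t * u j"] by blast
    define s where "s = (\<Sum>j\<in>T'. u j * c j)"
    \<comment> \<open>Back substitution: the value at \<open>t\<close> is the one that the pivot
      equation forces.\<close>
    define d where "d = c(t := - s)"
    have sum_d: "(\<Sum>j\<in>T. a k j * d j) = (\<Sum>j\<in>T'. a k j * c j) - a k t * s" for k
    proof -
      have "(\<Sum>j\<in>T'. a k j * d j) = (\<Sum>j\<in>T'. a k j * c j)"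
        using fin by (intro sum.cong) (auto simp: d_def)
      then show ?thesis
        using fin by (simp add: T d_def)
    qed
    have "a i t * s = (\<Sum>j\<in>T'. a i j * c j)"
      unfolding s_def sum_distrib_left u_def using t
      by (intro sum.cong) (simp_all flip: mult.assoc)
    then have "(\<Sum>j\<in>T. a i j * d j) = 0"
      by (simp add: sum_d)
    moreover have "(\<Sum>j\<in>T. a k j * d j) = 0" if "k \<in> I" for k
      using sol[OF that]
      by (simp add: sum_d s_def sum_distrib_left left_diff_distrib sum_subtractf mult.assoc)
    moreover have "\<exists>j\<in>T. d j \<noteq> 0"
      using c fin by (auto simp: d_def T)
    ultimately show ?thesis
      by (intro exI[of _ d]) auto
  qed
qed

lemma finite_right_indep_cols: "finite {S. right_indep_cols A S}"
  by (rule finite_subset[of _ "Pow {..<dim_col A}"]) (auto simp: right_indep_cols_def)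

lemma right_indep_cols_empty: "right_indep_cols A {}"
  by (simp add: right_indep_cols_def)

lemma card_le_qrank: "right_indep_cols A S \<Longrightarrow> card S \<le> qrank A"
  unfolding qrank_def using finite_right_indep_cols by (intro Max_ge) auto

lemma qrank_witness: obtains S where "right_indep_cols A S" "card S = qrank A"
proof -
  have "qrank A \<in> card ` {S. right_indep_cols A S}"
    unfolding qrank_def using finite_right_indep_cols right_indep_cols_empty
    by (intro Max_in) auto
  then show thesis
    using that by auto
qed

section \<open>Entries and algebra of matrix products\<close>

lemma mult_mat_entry:
  fixes A B :: "'a::semiring_0 mat"
  assumes "i < dim_row A" "j < dim_col B" "dim_col A = dim_row B"
  shows "(A * B) $$ (i, j) = (\<Sum>k<dim_row B. A $$ (i, k) * B $$ (k, j))"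
  using assms by (simp add: scalar_prod_def atLeast0LessThan)

text \<open>With dimension equations as hypotheses, every variable occurs in the left-hand side, so
  the simplifier can rewrite with the rule and discharge its conditions. The next two lemmas have
  this form for the same reason.\<close>

lemma assoc_mult_mat_dim:
  fixes A B C :: "'a::semiring_0 mat"
  assumes "dim_col A = dim_row B" "dim_col B = dim_row C"
  shows "A * B * C = A * (B * C)"
  using assms by (intro assoc_mult_mat[of _ "dim_row A" "dim_col A" _ "dim_col B" _ "dim_col C"]) auto

lemma mult_minus_distrib_mat_dim:
  fixes A B C :: "'a::ring mat"
  assumes "dim_col A = dim_row B" "dim_row C = dim_row B" "dim_col C = dim_col B"
  shows "A * (B - C) = A * B - A * C"
  using assms by (intro mult_minus_distrib_mat[of _ "dim_row A" "dim_col A" _ "dim_col B"]) auto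

lemma minus_mult_distrib_mat_dim:
  fixes A B C :: "'a::ring mat"
  assumes "dim_col A = dim_row C" "dim_row B = dim_row A" "dim_col B = dim_col A"
  shows "(A - B) * C = A * C - B * C"
  using assms by (intro minus_mult_distrib_mat[of _ "dim_row A" "dim_col A" _ _ "dim_col C"]) auto

section \<open>Rank of a product\<close>

text \<open>A right linear relation among columns of \<open>C\<close> holds with the same
  coefficients among the columns of \<open>P * C\<close>. Hence columns independent in
  \<open>P * C\<close> are independent in \<open>C\<close>.\<close>

lemma qrank_mult_left_le:
  assumes "P \<in> carrier_mat m n" "C \<in> carrier_mat n r"
  shows "qrank (P * C) \<le> qrank C"
proof -
  obtain S where S: "right_indep_cols (P * C) S" "card S = qrank (P * C)"
    by (rule qrank_witness)
  have "right_indep_cols C S"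
    unfolding right_indep_cols_def
  proof (intro conjI allI impI)
    show sub: "S \<subseteq> {..<dim_col C}"
      using S(1) by (simp add: right_indep_cols_def)
    fix c assume c: "\<forall>i<dim_row C. (\<Sum>j\<in>S. C $$ (i, j) * c j) = 0"
    have "(\<Sum>j\<in>S. (P * C) $$ (i, j) * c j) = 0" if "i < m" for i
    proof -
      have "(\<Sum>j\<in>S. (P * C) $$ (i, j) * c j)
          = (\<Sum>j\<in>S. \<Sum>k<n. P $$ (i, k) * (C $$ (k, j) * c j))"
        using that assms sub
        by (intro sum.cong refl, subst mult_mat_entry) (auto simp: sum_distrib_right mult.assoc)
      also have "\<dots> = (\<Sum>k<n. P $$ (i, k) * (\<Sum>j\<in>S. C $$ (k, j) * c j))"
        by (subst sum.swap) (simp add: sum_distrib_left)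
      also have "\<dots> = 0"
        using c assms by simp
      finally show ?thesis .
    qed
    then show "\<forall>j\<in>S. c j = 0"
      using S(1) assms unfolding right_indep_cols_def by auto
  qed
  then show ?thesis
    using card_le_qrank S(2) by metis
qed

text \<open>Adding column \<open>j\<close> to a family of maximal size creates a relation. Its
  coefficient at \<open>j\<close> is nonzero because \<open>S\<close> is independent, so the
  relation can be solved for column \<open>j\<close> by dividing from the right.\<close>

lemma columns_in_span_of_maximal:
  assumes S: "right_indep_cols C S" "card S = qrank C" and j: "j < dim_col C"
  shows "\<exists>d. \<forall>i<dim_row C. C $$ (i, j) = (\<Sum>s\<in>S. C $$ (i, s) * d s)"
proof (cases "j \<in> S")
  case True
  have "finite S"
    using S(1) by (auto simp: right_indep_cols_def intro: finite_subset)
  with True have "C $$ (i, j) = (\<Sum>s\<in>S. C $$ (i, s) * (if s = j then 1 else 0))" for i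
    by (simp add: if_distrib cong: if_cong)
  then show ?thesis by (intro exI[of _ "\<lambda>s. if s = j then 1 else 0"]) blast
next
  case False
  have sub: "S \<subseteq> {..<dim_col C}"
    using S(1) by (simp add: right_indep_cols_def)
  then have fin: "finite S"
    by (rule finite_subset) simp
  have "\<not> right_indep_cols C (insert j S)"
    using card_le_qrank[of C "insert j S"] S(2) False fin by auto
  then obtain c where c: "\<And>i. i < dim_row C \<Longrightarrow> C $$ (i, j) * c j + (\<Sum>s\<in>S. C $$ (i, s) * c s) = 0"
    and nz: "\<exists>s\<in>insert j S. c s \<noteq> 0"
    using sub j fin False unfolding right_indep_cols_def by auto
  have cj: "c j \<noteq> 0"
  proof
    assume "c j = 0"
    with c have "\<forall>i<dim_row C. (\<Sum>s\<in>S. C $$ (i, s) * c s) = 0" by simp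
    with S(1) have "\<forall>s\<in>S. c s = 0"
      unfolding right_indep_cols_def by blast
    with nz \<open>c j = 0\<close> show False by auto
  qed
  have "C $$ (i, j) = (\<Sum>s\<in>S. C $$ (i, s) * - (c s * inverse (c j)))" if "i < dim_row C" for i
  proof -
    have "C $$ (i, j) = C $$ (i, j) * c j * inverse (c j)"
      using cj by (simp add: mult.assoc)
    also have "C $$ (i, j) * c j = - (\<Sum>s\<in>S. C $$ (i, s) * c s)"
      using c[OF that] by (simp add: eq_neg_iff_add_eq_0)
    finally show ?thesis
      by (simp add: sum_distrib_right sum_negf mult.assoc)
  qed
  then show ?thesis by (intro exI allI impI)
qed

text \<open>All columns of \<open>C * Q\<close> are right combinations of the columns in a maximal
  independent family \<open>S\<close> of \<open>C\<close>, and more than \<open>card S\<close> such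
  combinations are dependent.\<close>

lemma qrank_mult_right_le:
  assumes "C \<in> carrier_mat m n" "Q \<in> carrier_mat n r"
  shows "qrank (C * Q) \<le> qrank C"
proof -
  obtain S where S: "right_indep_cols C S" "card S = qrank C"
    by (rule qrank_witness)
  obtain T where T: "right_indep_cols (C * Q) T" "card T = qrank (C * Q)"
    by (rule qrank_witness)
  have fin: "finite S" "finite T" and T_sub: "T \<subseteq> {..<r}"
    using S(1) T(1) assms by (auto simp: right_indep_cols_def intro: finite_subset)
  have "\<forall>k. \<exists>d. k < n \<longrightarrow> (\<forall>i<m. C $$ (i, k) = (\<Sum>s\<in>S. C $$ (i, s) * d s))"
    using columns_in_span_of_maximal[OF S] assms by auto
  then obtain D where D: "\<And>k i. k < n \<Longrightarrow> i < m \<Longrightarrow> C $$ (i, k) = (\<Sum>s\<in>S. C $$ (i, s) * D k s)"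
    by metis
  \<comment> \<open>Coordinates of column \<open>t\<close> of \<open>C * Q\<close> with respect to
    the family \<open>S\<close>.\<close>
  define E where "E s t = (\<Sum>k<n. D k s * Q $$ (k, t))" for s t
  have CQ: "(C * Q) $$ (i, t) = (\<Sum>s\<in>S. C $$ (i, s) * E s t)" if "i < m" "t < r" for i t
  proof -
    have "(C * Q) $$ (i, t) = (\<Sum>k<n. C $$ (i, k) * Q $$ (k, t))"
      using that assms by (subst mult_mat_entry) auto
    also have "\<dots> = (\<Sum>k<n. \<Sum>s\<in>S. C $$ (i, s) * (D k s * Q $$ (k, t)))"
    proof (rule sum.cong)
      fix k assume "k \<in> {..<n}"
      then have "C $$ (i, k) * Q $$ (k, t) = (\<Sum>s\<in>S. C $$ (i, s) * D k s) * Q $$ (k, t)"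
        using D[of k i] that by simp
      then show "C $$ (i, k) * Q $$ (k, t) = (\<Sum>s\<in>S. C $$ (i, s) * (D k s * Q $$ (k, t)))"
        by (simp add: sum_distrib_right mult.assoc)
    qed simp
    also have "\<dots> = (\<Sum>s\<in>S. C $$ (i, s) * E s t)"
      unfolding E_def by (subst sum.swap) (simp add: sum_distrib_left)
    finally show ?thesis .
  qed
  have "\<not> card S < card T"
  proof
    assume "card S < card T"
    \<comment> \<open>A nontrivial solution for the coordinates \<open>E\<close> is a nontrivial
      relation among the columns of \<open>C * Q\<close> in \<open>T\<close>.\<close>
    then obtain c where nz: "\<exists>t\<in>T. c t \<noteq> 0" and c: "\<forall>s\<in>S. (\<Sum>t\<in>T. E s t * c t) = 0"
      using homogeneous_system_nontrivial_solution[OF fin, of E] by blast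
    have "(\<Sum>t\<in>T. (C * Q) $$ (i, t) * c t) = 0" if "i < m" for i
    proof -
      have "(\<Sum>t\<in>T. (C * Q) $$ (i, t) * c t) = (\<Sum>t\<in>T. \<Sum>s\<in>S. C $$ (i, s) * (E s t * c t))"
        using that T_sub by (intro sum.cong) (auto simp: CQ sum_distrib_right mult.assoc)
      also have "\<dots> = (\<Sum>s\<in>S. C $$ (i, s) * (\<Sum>t\<in>T. E s t * c t))"
        by (subst sum.swap) (simp add: sum_distrib_left)
      also have "\<dots> = 0"
        using c by simp
      finally show ?thesis .
    qed
    then have "\<forall>t\<in>T. c t = 0"
      using T(1) assms unfolding right_indep_cols_def by auto
    with nz show False by blast
  qed
  then show ?thesis
    using S(2) T(2) by simp
qed

section \<open>The Frobenius inner product\<close>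

text \<open>For matrices of equal size this is the real part of the trace of
  \<open>A\<^sup>H * B\<close>. A real-valued form avoids the question on which side quaternion
  scalars act.\<close>

definition frob_inner :: "quat mat \<Rightarrow> quat mat \<Rightarrow> real" where
  "frob_inner A B = (\<Sum>i<dim_row A. \<Sum>j<dim_col A. inner (A $$ (i, j)) (B $$ (i, j)))"

lemma frob_norm_sq: "(frob_norm A)\<^sup>2 = frob_inner A A"
  by (simp add: frob_norm_def frob_inner_def power2_norm_eq_inner sum_nonneg)

lemma frob_norm_nonneg: "0 \<le> frob_norm A"
  by (simp add: frob_norm_def sum_nonneg)

text \<open>Flattening the double sum to index pairs makes Minkowski's inequality for
  \<open>L2_set\<close> applicable.\<close>

lemma frob_norm_L2_set:
  assumes "A \<in> carrier_mat m n"
  shows "frob_norm A = L2_set (\<lambda>x. norm (A $$ x)) ({..<m} \<times> {..<n})"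
  using assms by (simp add: frob_norm_def L2_set_def sum.cartesian_product case_prod_unfold)

lemma frob_norm_triangle:
  assumes "A \<in> carrier_mat m n" "B \<in> carrier_mat m n"
  shows "frob_norm (A + B) \<le> frob_norm A + frob_norm B"
proof -
  have "frob_norm (A + B) = L2_set (\<lambda>x. norm ((A + B) $$ x)) ({..<m} \<times> {..<n})"
    using assms by (intro frob_norm_L2_set) auto
  also have "\<dots> \<le> L2_set (\<lambda>x. norm (A $$ x) + norm (B $$ x)) ({..<m} \<times> {..<n})"
    using assms by (intro L2_set_mono) (auto intro: norm_triangle_ineq)
  also have "\<dots> \<le> frob_norm A + frob_norm B"
    unfolding frob_norm_L2_set[OF assms(1)] frob_norm_L2_set[OF assms(2)]
    by (rule L2_set_triangle_ineq)
  finally show ?thesis .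
qed

lemma frob_norm_sq_add:
  assumes "A \<in> carrier_mat m n" "B \<in> carrier_mat m n"
  shows "(frob_norm (A + B))\<^sup>2 = (frob_norm A)\<^sup>2 + 2 * frob_inner A B + (frob_norm B)\<^sup>2"
proof -
  have "inner (x + y) (x + y) = inner x x + 2 * inner x y + inner y y" for x y :: quat
    by (simp add: inner_add inner_commute)
  then show ?thesis
    using assms unfolding frob_norm_sq
    by (simp add: frob_inner_def sum.distrib sum_distrib_left)
qed

section \<open>Conjugate transposes as adjoints\<close>

lemma herm_carrier [simp]: "A \<in> carrier_mat m n \<Longrightarrow> A\<^sup>H \<in> carrier_mat n m"
  by (auto simp: herm_def)

lemma herm_dim [simp]: "dim_row (A\<^sup>H) = dim_col A" "dim_col (A\<^sup>H) = dim_row A"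
  by (simp_all add: herm_def)

lemma herm_index: "i < dim_col A \<Longrightarrow> j < dim_row A \<Longrightarrow> A\<^sup>H $$ (i, j) = qcnj (A $$ (j, i))"
  by (simp add: herm_def)

lemma inner_mult_left_quat: "inner (q * x) y = inner x (qcnj q * y)" for q x y :: quat
  by (simp add: inner_quat_def algebra_simps)

text \<open>\<open>inner x y\<close> is the real part of \<open>qcnj x * y\<close>, and the real
  part of a product is invariant under cyclic permutation of the factors.\<close>

lemma inner_mult_qcnj_right_quat: "inner (x * qcnj q) y = inner x (y * q)" for q x y :: quat
  by (simp add: inner_quat_def algebra_simps)

text \<open>Adjointness holds for each product of entries by \<open>inner_mult_left_quat\<close>;
  the rest is exchange of finite sums.\<close>

lemma frob_inner_mult_left:
  assumes "Q \<in> carrier_mat m k" "Y \<in> carrier_mat k n" "Z \<in> carrier_mat m n"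
  shows "frob_inner (Q * Y) Z = frob_inner Y (Q\<^sup>H * Z)"
proof -
  have QZ: "(Q\<^sup>H * Z) $$ (h, j) = (\<Sum>i<m. qcnj (Q $$ (i, h)) * Z $$ (i, j))"
    if "h < k" "j < n" for h j
    using that assms herm_carrier[OF assms(1)]
    by (subst mult_mat_entry) (auto simp: herm_index)
  have "frob_inner (Q * Y) Z = (\<Sum>i<m. \<Sum>j<n. \<Sum>h<k. inner (Q $$ (i, h) * Y $$ (h, j)) (Z $$ (i, j)))"
    unfolding frob_inner_def using assms
    by (auto simp: mult_mat_entry inner_sum_left simp del: index_mult_mat(1) intro!: sum.cong)
  also have "\<dots> = (\<Sum>i<m. \<Sum>j<n. \<Sum>h<k. inner (Y $$ (h, j)) (qcnj (Q $$ (i, h)) * Z $$ (i, j)))"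
    by (simp only: inner_mult_left_quat)
  \<comment> \<open>Three exchanges turn the order \<open>i\<close>, \<open>j\<close>,
    \<open>h\<close> into \<open>h\<close>, \<open>j\<close>, \<open>i\<close>, so that the outer
    sums run over the entries of \<open>Y\<close>.\<close>
  also have "\<dots> = (\<Sum>i<m. \<Sum>h<k. \<Sum>j<n. inner (Y $$ (h, j)) (qcnj (Q $$ (i, h)) * Z $$ (i, j)))"
    by (intro sum.cong refl sum.swap)
  also have "\<dots> = (\<Sum>h<k. \<Sum>i<m. \<Sum>j<n. inner (Y $$ (h, j)) (qcnj (Q $$ (i, h)) * Z $$ (i, j)))"
    by (rule sum.swap)
  also have "\<dots> = (\<Sum>h<k. \<Sum>j<n. \<Sum>i<m. inner (Y $$ (h, j)) (qcnj (Q $$ (i, h)) * Z $$ (i, j)))"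
    by (intro sum.cong refl sum.swap)
  also have "\<dots> = frob_inner Y (Q\<^sup>H * Z)"
    unfolding frob_inner_def using assms
    by (auto simp: QZ inner_sum_right simp del: index_mult_mat(1) intro!: sum.cong)
  finally show ?thesis .
qed

lemma frob_inner_mult_herm_right:
  assumes "Y \<in> carrier_mat m k" "Q \<in> carrier_mat n k" "Z \<in> carrier_mat m n"
  shows "frob_inner (Y * Q\<^sup>H) Z = frob_inner Y (Z * Q)"
proof -
  have YQ: "(Y * Q\<^sup>H) $$ (i, j) = (\<Sum>h<k. Y $$ (i, h) * qcnj (Q $$ (j, h)))"
    if "i < m" "j < n" for i j
    using that assms herm_carrier[OF assms(2)]
    by (subst mult_mat_entry) (auto simp: herm_index)
  have "frob_inner (Y * Q\<^sup>H) Z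
      = (\<Sum>i<m. \<Sum>j<n. \<Sum>h<k. inner (Y $$ (i, h) * qcnj (Q $$ (j, h))) (Z $$ (i, j)))"
    unfolding frob_inner_def using assms herm_carrier[OF assms(2)]
    by (auto simp: YQ inner_sum_left simp del: index_mult_mat(1) intro!: sum.cong)
  also have "\<dots> = (\<Sum>i<m. \<Sum>j<n. \<Sum>h<k. inner (Y $$ (i, h)) (Z $$ (i, j) * Q $$ (j, h)))"
    by (simp only: inner_mult_qcnj_right_quat)
  also have "\<dots> = (\<Sum>i<m. \<Sum>h<k. \<Sum>j<n. inner (Y $$ (i, h)) (Z $$ (i, j) * Q $$ (j, h)))"
    by (intro sum.cong refl sum.swap)
  also have "\<dots> = frob_inner Y (Z * Q)"
    unfolding frob_inner_def using assms
    by (auto simp: mult_mat_entry inner_sum_right simp del: index_mult_mat(1) intro!: sum.cong)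
  finally show ?thesis .
qed

section \<open>Compression by matrices with orthonormal columns\<close>

text \<open>An exact identity rather than an estimate: the term without \<open>X\<close> cancels
  when two candidates are compared.\<close>

lemma frob_norm_compression:
  assumes A: "A \<in> carrier_mat m n" and Q1: "Q1 \<in> carrier_mat m l" and Q2: "Q2 \<in> carrier_mat n k"
    and orth: "Q1\<^sup>H * Q1 = 1\<^sub>m l" "Q2\<^sup>H * Q2 = 1\<^sub>m k" and X: "X \<in> carrier_mat l k"
  shows "(frob_norm (A - Q1 * X * Q2\<^sup>H))\<^sup>2
    = (frob_norm (A - Q1 * (Q1\<^sup>H * A * Q2) * Q2\<^sup>H))\<^sup>2 + (frob_norm (Q1\<^sup>H * A * Q2 - X))\<^sup>2"
proof -
  note dims = carrier_matD[OF A] carrier_matD[OF Q1] carrier_matD[OF Q2] carrier_matD[OF X]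
  define B where "B = Q1\<^sup>H * A * Q2"
  define D where "D = B - X"
  define R where "R = A - Q1 * B * Q2\<^sup>H"
  have B: "B \<in> carrier_mat l k" and D: "D \<in> carrier_mat l k"
    by (auto intro!: carrier_matI simp: B_def D_def dims)
  have R: "R \<in> carrier_mat m n"
    by (auto intro!: carrier_matI simp: R_def dims)
  \<comment> \<open>Compression is a left inverse of the lifting
    \<open>Y \<mapsto> Q1 * Y * Q2\<^sup>H\<close>, and by \<open>adj\<close> below it is also the
    adjoint. Together the two facts make the lifting an isometry.\<close>
  have compress: "Q1\<^sup>H * (Q1 * Y * Q2\<^sup>H) * Q2 = Y" if Y: "Y \<in> carrier_mat l k" for Y
  proof -
    have "Q1\<^sup>H * (Q1 * Y * Q2\<^sup>H) * Q2 = Q1\<^sup>H * Q1 * Y * (Q2\<^sup>H * Q2)"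
      by (simp add: assoc_mult_mat_dim dims carrier_matD[OF Y])
    then show ?thesis
      using Y by (simp add: orth)
  qed
  have adj: "frob_inner (Q1 * Y * Q2\<^sup>H) Z = frob_inner Y (Q1\<^sup>H * Z * Q2)"
    if Y: "Y \<in> carrier_mat l k" and Z: "Z \<in> carrier_mat m n" for Y Z
  proof -
    have "frob_inner (Q1 * Y * Q2\<^sup>H) Z = frob_inner (Q1 * Y) (Z * Q2)"
      using Q1 Q2 Y Z by (intro frob_inner_mult_herm_right) auto
    also have "\<dots> = frob_inner Y (Q1\<^sup>H * (Z * Q2))"
      using Q1 Q2 Y Z by (intro frob_inner_mult_left) auto
    also have "Q1\<^sup>H * (Z * Q2) = Q1\<^sup>H * Z * Q2"
      by (simp add: assoc_mult_mat_dim dims carrier_matD[OF Z])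
    finally show ?thesis .
  qed
  have QDQ: "Q1 * D * Q2\<^sup>H \<in> carrier_mat m n" and QBQ: "Q1 * B * Q2\<^sup>H \<in> carrier_mat m n"
    and QXQ: "Q1 * X * Q2\<^sup>H \<in> carrier_mat m n"
    by (auto intro!: carrier_matI simp: dims)
  \<comment> \<open>The residual \<open>R\<close> compresses to zero, so by adjointness it is
    orthogonal to every lifted matrix.\<close>
  have "Q1\<^sup>H * R * Q2 = Q1\<^sup>H * A * Q2 - Q1\<^sup>H * (Q1 * B * Q2\<^sup>H) * Q2"
    unfolding R_def
    by (simp add: mult_minus_distrib_mat_dim minus_mult_distrib_mat_dim dims)
  also have "\<dots> = 0\<^sub>m l k"
    unfolding compress[OF B] using B by (simp flip: B_def)
  finally have "frob_inner (Q1 * D * Q2\<^sup>H) R = 0"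
    unfolding adj[OF D R] using D by (simp add: frob_inner_def)
  moreover have "(frob_norm (Q1 * D * Q2\<^sup>H))\<^sup>2 = (frob_norm D)\<^sup>2"
    by (simp add: frob_norm_sq adj[OF D QDQ] compress[OF D])
  moreover have "A - Q1 * X * Q2\<^sup>H = Q1 * D * Q2\<^sup>H + R"
  proof -
    have "Q1 * D * Q2\<^sup>H = Q1 * B * Q2\<^sup>H - Q1 * X * Q2\<^sup>H"
      unfolding D_def
      by (simp add: mult_minus_distrib_mat_dim minus_mult_distrib_mat_dim dims carrier_matD[OF B])
    then show ?thesis
      unfolding R_def using A QBQ QXQ by (intro eq_matI) auto
  qed
  ultimately show ?thesis
    using frob_norm_sq_add[OF QDQ R] by (simp add: B_def D_def R_def)
qed

text \<open>Pythagoras for the splitting of \<open>Z\<close> into its projection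
  \<open>Q * Y\<close> and the remainder \<open>R\<close>, which \<open>Q\<^sup>H\<close>
  annihilates.\<close>

lemma frob_norm_projection_le:
  assumes Q: "Q \<in> carrier_mat m k" and orth: "Q\<^sup>H * Q = 1\<^sub>m k" and Z: "Z \<in> carrier_mat m n"
  shows "frob_norm (Q * (Q\<^sup>H * Z)) \<le> frob_norm Z"
proof -
  define Y where "Y = Q\<^sup>H * Z"
  define R where "R = Z - Q * Y"
  note dims = carrier_matD[OF Q] carrier_matD[OF Z]
  have Y: "Y \<in> carrier_mat k n" and QY: "Q * Y \<in> carrier_mat m n" and R: "R \<in> carrier_mat m n"
    by (auto intro!: carrier_matI simp: Y_def R_def dims)
  have "Q\<^sup>H * R = Y - Q\<^sup>H * Q * Y"
    unfolding R_def Y_def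
    by (simp add: mult_minus_distrib_mat_dim assoc_mult_mat_dim dims)
  also have "\<dots> = 0\<^sub>m k n"
    using Y by (simp add: orth)
  finally have "frob_inner (Q * Y) R = 0"
    unfolding frob_inner_mult_left[OF Q Y R] using Y by (simp add: frob_inner_def)
  moreover have "Z = Q * Y + R"
    unfolding R_def using Z QY by (intro eq_matI) auto
  ultimately have "(frob_norm Z)\<^sup>2 = (frob_norm (Q * Y))\<^sup>2 + (frob_norm R)\<^sup>2"
    using frob_norm_sq_add[OF QY R] by simp
  then have "(frob_norm (Q * Y))\<^sup>2 \<le> (frob_norm Z)\<^sup>2"
    by simp
  then show ?thesis
    unfolding Y_def by (rule power2_le_imp_le) (rule frob_norm_nonneg)
qed

text \<open>The path from \<open>A\<close> to the two-sided projection of \<open>C\<close> passes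
  through \<open>C\<close> and its left projection. The last leg is the left projection of
  \<open>C - C * Q2 * Q2\<^sup>H\<close>, and projecting does not lengthen it.\<close>

lemma frob_norm_two_sided_projection_le:
  assumes A: "A \<in> carrier_mat m n" and C: "C \<in> carrier_mat m n"
    and Q1: "Q1 \<in> carrier_mat m l" and Q2: "Q2 \<in> carrier_mat n k" and orth: "Q1\<^sup>H * Q1 = 1\<^sub>m l"
  shows "frob_norm (A - Q1 * (Q1\<^sup>H * C * Q2) * Q2\<^sup>H)
    \<le> frob_norm (A - C) + frob_norm (C - Q1 * Q1\<^sup>H * C) + frob_norm (C - C * Q2 * Q2\<^sup>H)"
proof -
  note dims = carrier_matD[OF A] carrier_matD[OF C] carrier_matD[OF Q1] carrier_matD[OF Q2]
  define W where "W = C * Q2 * Q2\<^sup>H"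
  have W: "W \<in> carrier_mat m n" and PC: "Q1 * (Q1\<^sup>H * C) \<in> carrier_mat m n"
    and PW: "Q1 * (Q1\<^sup>H * W) \<in> carrier_mat m n"
    by (auto intro!: carrier_matI simp: W_def dims)
  have "Q1 * (Q1\<^sup>H * C * Q2) * Q2\<^sup>H = Q1 * (Q1\<^sup>H * W)"
    unfolding W_def by (simp add: assoc_mult_mat_dim dims)
  moreover have "Q1 * Q1\<^sup>H * C = Q1 * (Q1\<^sup>H * C)"
    by (simp add: assoc_mult_mat_dim dims)
  moreover have "A - Q1 * (Q1\<^sup>H * W)
      = (A - C) + (C - Q1 * (Q1\<^sup>H * C)) + Q1 * (Q1\<^sup>H * (C - W))"
  proof -
    \<comment> \<open>Applied with \<open>U\<close> the left projection of \<open>C\<close> and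
      \<open>V\<close> its two-sided projection.\<close>
    have telescope: "A - V = (A - C) + (C - U) + (U - V)"
      if "U \<in> carrier_mat m n" "V \<in> carrier_mat m n" for U V
      using A C that by (intro eq_matI) auto
    have "Q1 * (Q1\<^sup>H * (C - W)) = Q1 * (Q1\<^sup>H * C) - Q1 * (Q1\<^sup>H * W)"
      by (simp add: mult_minus_distrib_mat_dim dims carrier_matD[OF W])
    then show ?thesis
      using telescope[OF PC PW] by (simp only:)
  qed
  moreover have "frob_norm ((A - C) + (C - Q1 * (Q1\<^sup>H * C)) + Q1 * (Q1\<^sup>H * (C - W)))
      \<le> frob_norm (A - C) + frob_norm (C - Q1 * (Q1\<^sup>H * C)) + frob_norm (Q1 * (Q1\<^sup>H * (C - W)))"
  proof -
    have c: "A - C \<in> carrier_mat m n" "C - Q1 * (Q1\<^sup>H * C) \<in> carrier_mat m n"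
      "Q1 * (Q1\<^sup>H * (C - W)) \<in> carrier_mat m n"
      by (auto intro!: carrier_matI simp: dims carrier_matD[OF W])
    show ?thesis
      using frob_norm_triangle[OF add_carrier_mat[OF c(2), of "A - C"] c(3)]
        frob_norm_triangle[OF c(1,2)] by linarith
  qed
  moreover have "frob_norm (Q1 * (Q1\<^sup>H * (C - W))) \<le> frob_norm (C - W)"
    using C W by (intro frob_norm_projection_le[OF Q1 orth]) auto
  ultimately show ?thesis
    by (simp flip: W_def)
qed

section \<open>Application to the output of the algorithm\<close>

lemma power_Y_carrier:
  assumes "A \<in> carrier_mat m n" "\<Omega> \<in> carrier_mat n l"
  shows "power_Y A \<Omega> i \<in> carrier_mat m l"
proof (rule carrier_matI)
  show "dim_row (power_Y A \<Omega> i) = m"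
    by (cases i) (simp_all add: carrier_matD[OF assms(1)])
  show "dim_col (power_Y A \<Omega> i) = l"
    by (induction i) (simp_all add: carrier_matD[OF assms(2)])
qed

theorem theorem5p1:
  fixes A \<Omega> Q1 Q2 M_K A_K :: "quat mat" and M N K l p :: nat
  assumes "A \<in> carrier_mat M N"
    and "1 \<le> K" and "K \<le> l" and "l \<le> min M N" and "1 \<le> p"
    and "cor_qurv A \<Omega> l p Q1 Q2"
    and "is_best_rank_approx K (Q1\<^sup>H * A * Q2) M_K"
    and "is_best_rank_approx K A A_K"
  shows "is_arg_min (\<lambda>X. frob_norm (A - Q1 * X * Q2\<^sup>H))
           (\<lambda>X. X \<in> carrier_mat l l \<and> qrank X \<le> K) M_K
    \<and> frob_norm (A - Q1 * M_K * Q2\<^sup>H)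
        \<le> frob_norm (A - A_K) + frob_norm (A_K - Q1 * Q1\<^sup>H * A_K)
          + frob_norm (A_K - A_K * Q2 * Q2\<^sup>H)"
proof -
  note A = assms(1)
  have \<Omega>: "\<Omega> \<in> carrier_mat N l"
    using assms(6) A by (simp add: cor_qurv_def)
  \<comment> \<open>Stated for every index, since \<open>power_Yhat\<close> at \<open>p\<close> is
    built from the iterate at \<open>p - 1\<close>.\<close>
  have Y: "power_Y A \<Omega> i \<in> carrier_mat M l" for i
    using A \<Omega> by (rule power_Y_carrier)
  have Yhat: "power_Yhat A \<Omega> p \<in> carrier_mat N l"
    unfolding power_Yhat_def using herm_carrier[OF A] Y by (rule mult_carrier_mat)
  have Q1: "Q1 \<in> carrier_mat M l" "Q1\<^sup>H * Q1 = 1\<^sub>m l"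
    and Q2: "Q2 \<in> carrier_mat N l" "Q2\<^sup>H * Q2 = 1\<^sub>m l"
    using assms(6) Y[of p] Yhat by (auto simp: cor_qurv_def thin_qr_def)
  define B where "B = Q1\<^sup>H * A * Q2"
  have B: "B \<in> carrier_mat l l"
    using carrier_matD[OF Q1(1)] carrier_matD[OF Q2(1)] by (intro carrier_matI) (simp_all add: B_def)
  have MK: "M_K \<in> carrier_mat l l" "qrank M_K \<le> K"
    and MK_min: "\<And>X. X \<in> carrier_mat l l \<Longrightarrow> qrank X \<le> K \<Longrightarrow>
      frob_norm (B - M_K) \<le> frob_norm (B - X)"
    using assms(7) B unfolding is_best_rank_approx_def is_arg_min_def
    by (auto simp flip: B_def simp: not_less)
  have AK: "A_K \<in> carrier_mat M N" "qrank A_K \<le> K"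
    using assms(8) A unfolding is_best_rank_approx_def is_arg_min_def by auto
  have opt: "frob_norm (A - Q1 * M_K * Q2\<^sup>H) \<le> frob_norm (A - Q1 * X * Q2\<^sup>H)"
    if X: "X \<in> carrier_mat l l" "qrank X \<le> K" for X
  proof (rule power2_le_imp_le)
    note compression = frob_norm_compression[OF A Q1(1) Q2(1) Q1(2) Q2(2), folded B_def]
    have "(frob_norm (B - M_K))\<^sup>2 \<le> (frob_norm (B - X))\<^sup>2"
      using MK_min[OF X] frob_norm_nonneg by (rule power_mono)
    then show "(frob_norm (A - Q1 * M_K * Q2\<^sup>H))\<^sup>2 \<le> (frob_norm (A - Q1 * X * Q2\<^sup>H))\<^sup>2"
      unfolding compression[OF MK(1)] compression[OF X(1)] by simp
  qed (rule frob_norm_nonneg)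
  \<comment> \<open>The compression of \<open>A_K\<close> is feasible: neither of its two outer
    factors can raise the rank of \<open>A_K\<close>.\<close>
  define X where "X = Q1\<^sup>H * A_K * Q2"
  have "qrank X \<le> qrank (Q1\<^sup>H * A_K)"
    unfolding X_def using herm_carrier[OF Q1(1)] AK Q2
    by (intro qrank_mult_right_le[of _ l N _ l]) auto
  also have "\<dots> \<le> qrank A_K"
    using herm_carrier[OF Q1(1)] AK by (intro qrank_mult_left_le[of _ l M _ N])
  finally have "qrank X \<le> K"
    using AK by simp
  moreover have "X \<in> carrier_mat l l"
    using carrier_matD[OF Q1(1)] carrier_matD[OF Q2(1)] by (intro carrier_matI) (simp_all add: X_def)
  ultimately have "frob_norm (A - Q1 * M_K * Q2\<^sup>H) \<le> frob_norm (A - Q1 * X * Q2\<^sup>H)"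
    by (intro opt)
  also have "\<dots> \<le> frob_norm (A - A_K) + frob_norm (A_K - Q1 * Q1\<^sup>H * A_K)
      + frob_norm (A_K - A_K * Q2 * Q2\<^sup>H)"
    unfolding X_def using A AK(1) Q1(1) Q2(1) Q1(2) by (rule frob_norm_two_sided_projection_le)
  finally show ?thesis
    using opt MK by (auto simp: is_arg_min_def not_less)
qed

end
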